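(* Let $\Phi$ be a non-flat LWR frame on $\widetilde\Sigma$ with monodromy $M$ (along a loop in $\Sigma$ with deck transformation $\tau$, i.e. $\tau^*\Phi=M\Phi$). Let $g=\mathrm{SF}(\alpha,\ell,m)$ be a $z$-independent simple factor. If $\ell$ is an eigenline of $M_\alpha$, then the monodromy $\hat M$ of $g\#\Phi$ (defined by $\tau^*(g\#\Phi)=\hat M\,(g\#\Phi)$) is $$\hat M=gMg^{-1}.$$
   Context: LWR potential on a Riemann surface $\Sigma$ (poles removed): family $\xi_\lambda$ ($\lambda\in\mathbb C$) of $\mathrm{sl}_2\mathbb C$-valued 1-forms on $\Sigma$, locally $\xi_\lambda=(A\lambda+B)dz$ with $A,B$ holomorphic in $z$, $A$ nilpotent. LWR frame: $\mathrm{SL}_2\mathbb C$-valued $\Phi_\lambda$ on the universal cover $\widetilde\Sigma$, holomorphic in $z$ and in $\lambda\in\mathbb C$, with $\Phi^{-1}d\Phi=\xi$. For a deck transformation $\tau$ of $\widetilde\Sigma\to\Sigma$, the monodromy $M=(M_\lambda)_{\lambda\in\mathbb C}$ is the $z$-independent, $\lambda$-holomorphic $\mathrm{SL}_2\mathbb C$-valued matrix with $\tau^*\Phi=M\Phi$. A spinor for $\xi$ is a (local) function $w=(a,b)$ with $A=w\,(-b\ \ a)$, unique up to sign. $\Phi$ is non-flat if $\det(\Phi_\lambda w,(\Phi_\lambda w)_z)$ (independent of $\lambda$) is not identically zero. Simple factor: for $\alpha\in\mathbb C$ and $\ell\neq m\in\mathbb CP^1$ (lines in $\mathbb C^2$),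 $\mathrm{SF}(\alpha,\ell,m):=S\Delta S^{-1}$ with $\Delta=\begin{pmatrix}\lambda-\alpha&0\\0&1\end{pmatrix}$ and $S\in \mathrm{GL}_2\mathbb C$ independent of $\lambda$ with first column in $\ell$ and second column in $m$. For a non-flat LWR frame $\Phi$ and a $z$-independent simple factor $g=\mathrm{SF}(\alpha,\ell,m)$, the simple factor dressing is $g\#\Phi:=g\Phi h^{-1}$, where $h=\mathrm{SF}(\alpha,\Phi_\alpha^{-1}\ell,\operatorname{span}w)$ is the unique $z$-dependent simple factor making $g\Phi h^{-1}$ an LWR frame (defined off a set of isolated points of $\widetilde\Sigma$). *)

theory Defs
  imports
    "HOL-Analysis.Homeomorphism"
    "HOL-Analysis.Complex_Analysis_Basics"
    "HOL-Analysis.Determinants"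
begin

section \<open>Riemann surfaces, universal covers and deck transformations\<close>

text \<open>
  A Riemann surface is a subset \<open>X\<close> of a Hausdorff type, with the subspace topology, together
  with a holomorphic atlas (not assumed maximal).  A chart is a pair of its domain and its
  coordinate function; values of the coordinate function outside the domain are irrelevant.
\<close>

type_synonym 'a chart = "'a set \<times> ('a \<Rightarrow> complex)"

abbreviation chart_dom :: "'a chart \<Rightarrow> 'a set" where "chart_dom \<equiv> fst"
abbreviation coord :: "'a chart \<Rightarrow> 'a \<Rightarrow> complex" where "coord \<equiv> snd"

definition chart_inv :: "'a chart \<Rightarrow> complex \<Rightarrow> 'a" where
  "chart_inv c = inv_into (chart_dom c) (coord c)"

definition is_chart :: "'a::topological_space set \<Rightarrow> 'a chart \<Rightarrow> bool" where
  "is_chart X c \<longleftrightarrow>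
     openin (top_of_set X) (chart_dom c) \<and>
     open (coord c ` chart_dom c) \<and>
     homeomorphism (chart_dom c) (coord c ` chart_dom c) (coord c) (chart_inv c)"

definition riemann_surface :: "'a::t2_space set \<Rightarrow> 'a chart set \<Rightarrow> bool" where
  "riemann_surface X \<A> \<longleftrightarrow>
     X \<noteq> {} \<and> connected X \<and>
     (\<forall>c\<in>\<A>. is_chart X c) \<and> (\<Union>c\<in>\<A>. chart_dom c) = X \<and>
     (\<forall>c\<in>\<A>. \<forall>d\<in>\<A>. (coord d \<circ> chart_inv c) holomorphic_on
                        coord c ` (chart_dom c \<inter> chart_dom d))"

definition holomorphic_map ::
    "'a::t2_space set \<Rightarrow> 'a chart set \<Rightarrow> 'b::t2_space set \<Rightarrow> 'b chart set \<Rightarrow> ('a \<Rightarrow> 'b) \<Rightarrow> bool" where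
  "holomorphic_map X \<A> Y \<B> f \<longleftrightarrow>
     continuous_on X f \<and> f ` X \<subseteq> Y \<and>
     (\<forall>c\<in>\<A>. \<forall>d\<in>\<B>. (coord d \<circ> f \<circ> chart_inv c) holomorphic_on
                        coord c ` (chart_dom c \<inter> f -` chart_dom d))"

definition universal_cover ::
    "'b::t2_space set \<Rightarrow> 'b chart set \<Rightarrow> ('b \<Rightarrow> 'a) \<Rightarrow> 'a::t2_space set \<Rightarrow> 'a chart set \<Rightarrow> bool" where
  "universal_cover Y \<B> p X \<A> \<longleftrightarrow>
     riemann_surface Y \<B> \<and> simply_connected Y \<and>
     covering_space Y p X \<and> holomorphic_map Y \<B> X \<A> p"

definition deck_transformation :: "'b::t2_space set \<Rightarrow> ('b \<Rightarrow> 'a) \<Rightarrow> ('b \<Rightarrow> 'b) \<Rightarrow> bool" where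
  "deck_transformation Y p \<tau> \<longleftrightarrow>
     (\<exists>\<sigma>. homeomorphism Y Y \<tau> \<sigma>) \<and> (\<forall>y\<in>Y. p (\<tau> y) = p y)"

definition hol_in_chart :: "'a chart \<Rightarrow> 'a set \<Rightarrow> ('a \<Rightarrow> complex) \<Rightarrow> bool" where
  "hol_in_chart c V f \<longleftrightarrow> (f \<circ> chart_inv c) holomorphic_on coord c ` V"

definition chart_deriv :: "'a chart \<Rightarrow> ('a \<Rightarrow> complex) \<Rightarrow> 'a \<Rightarrow> complex" where
  "chart_deriv c f x = deriv (f \<circ> chart_inv c) (coord c x)"


section \<open>LWR potentials and frames\<close>

type_synonym mat2 = "complex^2^2"

text \<open>
  A matrix-valued (1,0)-form \<open>\<omega>\<close> is given by its coefficient functions: on the domain of the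
  chart \<open>c\<close> with coordinate \<open>z\<close>, the form is \<open>\<omega> c dz\<close>.  Scalar multiples of a matrix are
  written \<open>mat k ** A\<close>, where \<open>mat k\<close> is the scalar matrix.  The spectral parameter, usually
  called lambda, is written \<open>\<mu>\<close>.
\<close>

type_synonym 'a form_coeffs = "'a chart \<Rightarrow> 'a \<Rightarrow> mat2"

definition is_one_form :: "'a chart set \<Rightarrow> 'a form_coeffs \<Rightarrow> bool" where
  "is_one_form \<A> \<omega> \<longleftrightarrow>
     (\<forall>c\<in>\<A>. \<forall>d\<in>\<A>. \<forall>x \<in> chart_dom c \<inter> chart_dom d.
        \<omega> c x = mat (chart_deriv c (coord d) x) ** \<omega> d x)"

definition is_pullback ::
    "'b chart set \<Rightarrow> ('b \<Rightarrow> 'a) \<Rightarrow> 'a chart set \<Rightarrow> 'a form_coeffs \<Rightarrow> 'b form_coeffs \<Rightarrow> bool" where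
  "is_pullback \<B> p \<A> \<omega> \<eta> \<longleftrightarrow>
     (\<forall>c\<in>\<B>. \<forall>d\<in>\<A>. \<forall>y \<in> chart_dom c \<inter> p -` chart_dom d.
        \<eta> c y = mat (chart_deriv c (coord d \<circ> p) y) ** \<omega> d (p y))"

definition nilpotent_mat :: "mat2 \<Rightarrow> bool" where
  "nilpotent_mat A \<longleftrightarrow> (\<exists>n. (((**) A) ^^ n) (mat 1) = 0)"

definition lwr_potential :: "'a chart set \<Rightarrow> (complex \<Rightarrow> 'a form_coeffs) \<Rightarrow> bool" where
  "lwr_potential \<A> \<xi> \<longleftrightarrow>
     (\<forall>\<mu>. is_one_form \<A> (\<xi> \<mu>)) \<and>
     (\<forall>\<mu>. \<forall>c\<in>\<A>. \<forall>x\<in>chart_dom c. trace (\<xi> \<mu> c x) = 0) \<and>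
     (\<forall>c\<in>\<A>. \<exists>A B :: 'a \<Rightarrow> mat2.
        (\<forall>i j. hol_in_chart c (chart_dom c) (\<lambda>x. A x $ i $ j)) \<and>
        (\<forall>i j. hol_in_chart c (chart_dom c) (\<lambda>x. B x $ i $ j)) \<and>
        (\<forall>x\<in>chart_dom c. nilpotent_mat (A x)) \<and>
        (\<forall>\<mu>. \<forall>x\<in>chart_dom c. \<xi> \<mu> c x = mat \<mu> ** A x + B x))"

text \<open>The coefficient \<open>A\<close> of a family of the form \<open>(A \<mu> + B) dz\<close>.\<close>

definition lambda_coeff :: "(complex \<Rightarrow> 'a form_coeffs) \<Rightarrow> 'a form_coeffs" where
  "lambda_coeff \<xi> c x = \<xi> 1 c x - \<xi> 0 c x"

text \<open>The form \<open>\<Phi>\<^sup>-\<^sup>1 d\<Phi>\<close>.\<close>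

definition frame_form :: "(complex \<Rightarrow> 'b \<Rightarrow> mat2) \<Rightarrow> complex \<Rightarrow> 'b form_coeffs" where
  "frame_form \<Phi> \<mu> c y =
     matrix_inv (\<Phi> \<mu> y) ** (\<chi> i j. chart_deriv c (\<lambda>x. \<Phi> \<mu> x $ i $ j) y)"

text \<open>
  \<open>\<Phi>\<close> is an LWR frame on the cover \<open>Y\<close> with potential \<open>\<xi>\<close> on the base; \<open>\<xi>\<close> is identified with
  its pullback by the covering map \<open>p\<close>.
\<close>

definition lwr_frame ::
    "'b set \<Rightarrow> 'b chart set \<Rightarrow> ('b \<Rightarrow> 'a) \<Rightarrow> 'a chart set \<Rightarrow>
     (complex \<Rightarrow> 'a form_coeffs) \<Rightarrow> (complex \<Rightarrow> 'b \<Rightarrow> mat2) \<Rightarrow> bool" where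
  "lwr_frame Y \<B> p \<A> \<xi> \<Phi> \<longleftrightarrow>
     (\<forall>\<mu>. \<forall>y\<in>Y. det (\<Phi> \<mu> y) = 1) \<and>
     (\<forall>\<mu>. \<forall>c\<in>\<B>. \<forall>i j. hol_in_chart c (chart_dom c) (\<lambda>y. \<Phi> \<mu> y $ i $ j)) \<and>
     (\<forall>y\<in>Y. \<forall>i j. (\<lambda>\<mu>. \<Phi> \<mu> y $ i $ j) holomorphic_on UNIV) \<and>
     (\<forall>\<mu>. is_pullback \<B> p \<A> (\<xi> \<mu>) (frame_form \<Phi> \<mu>))"

text \<open>
  Monodromy of an \<open>SL\<^sub>2\<close>-valued map \<open>\<Psi>\<close> given on \<open>D\<close>.  The domain has to be invariant, so that
  \<open>\<tau>\<^sup>*\<Psi>\<close> makes sense on all of \<open>D\<close>.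
\<close>

definition is_monodromy ::
    "'b set \<Rightarrow> ('b \<Rightarrow> 'b) \<Rightarrow> (complex \<Rightarrow> 'b \<Rightarrow> mat2) \<Rightarrow> (complex \<Rightarrow> mat2) \<Rightarrow> bool" where
  "is_monodromy D \<tau> \<Psi> M \<longleftrightarrow>
     (\<forall>\<mu>. det (M \<mu>) = 1) \<and>
     (\<forall>i j. (\<lambda>\<mu>. M \<mu> $ i $ j) holomorphic_on UNIV) \<and>
     (\<forall>y\<in>D. \<tau> y \<in> D \<and> (\<forall>\<mu>. \<Psi> \<mu> (\<tau> y) = M \<mu> ** \<Psi> \<mu> y))"


section \<open>Spinors\<close>

text \<open>\<open>A = w (-b  a)\<close> for the column \<open>w = (a, b)\<close>.\<close>

definition spinor_value :: "mat2 \<Rightarrow> complex^2 \<Rightarrow> bool" where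
  "spinor_value A w \<longleftrightarrow> A = (\<chi> i j. w $ i * (vector [- (w $ 2), w $ 1] :: complex^2) $ j)"

definition local_spinor ::
    "'b::topological_space set \<Rightarrow> (complex \<Rightarrow> 'b form_coeffs) \<Rightarrow> 'b chart \<Rightarrow> 'b set \<Rightarrow>
     ('b \<Rightarrow> complex^2) \<Rightarrow> bool" where
  "local_spinor Y \<xi> c V w \<longleftrightarrow>
     V \<subseteq> chart_dom c \<and> openin (top_of_set Y) V \<and>
     (\<forall>i. hol_in_chart c V (\<lambda>y. w y $ i)) \<and>
     (\<forall>y\<in>V. spinor_value (lambda_coeff \<xi> c y) (w y))"

text \<open>
  Non-flatness: \<open>det (\<Phi> w, (\<Phi> w)\<^sub>z)\<close> does not vanish identically.  For a frame this determinant
  does not depend on \<open>\<mu>\<close>, so it makes no difference which \<open>\<mu>\<close> is used.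
\<close>

definition non_flat ::
    "'b::topological_space set \<Rightarrow> 'b chart set \<Rightarrow> (complex \<Rightarrow> 'b \<Rightarrow> mat2) \<Rightarrow> bool" where
  "non_flat Y \<B> \<Phi> \<longleftrightarrow>
     (\<exists>c\<in>\<B>. \<exists>V w. local_spinor Y (frame_form \<Phi>) c V w \<and>
        (\<exists>y\<in>V. \<exists>\<mu>.
           det (transpose (vector
             [\<Phi> \<mu> y *v w y,
              \<chi> i. chart_deriv c (\<lambda>x. (\<Phi> \<mu> x *v w x) $ i) y] :: mat2)) \<noteq> 0))"

text \<open>
  The span of the spinor values at a point.  Changing the chart or the sign only rescales the
  spinor, so the union runs over copies of a single set; it is a line unless \<open>A\<close> vanishes at \<open>y\<close>.
\<close>

definition spinor_span ::
    "'b chart set \<Rightarrow> (complex \<Rightarrow> 'b form_coeffs) \<Rightarrow> 'b \<Rightarrow> (complex^2) set" where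
  "spinor_span \<B> \<xi> y =
     \<Union> {vec.span {w} | w. \<exists>c\<in>\<B>. y \<in> chart_dom c \<and> spinor_value (lambda_coeff \<xi> c y) w}"


section \<open>Simple factors and simple factor dressing\<close>

definition is_line :: "(complex^2) set \<Rightarrow> bool" where
  "is_line L \<longleftrightarrow> (\<exists>v. v \<noteq> 0 \<and> L = vec.span {v})"

text \<open>Meaningful for distinct lines; the result does not depend on the choice of \<open>S\<close>.\<close>

definition simple_factor ::
    "complex \<Rightarrow> (complex^2) set \<Rightarrow> (complex^2) set \<Rightarrow> complex \<Rightarrow> mat2" where
  "simple_factor \<alpha> L K =
     (THE G. \<exists>S::mat2. invertible S \<and> column 1 S \<in> L \<and> column 2 S \<in> K \<and>
        G = (\<lambda>\<mu>. S ** vector [vector [\<mu> - \<alpha>, 0], vector [0, 1]] ** matrix_inv S))"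

definition dressing_line ::
    "complex \<Rightarrow> (complex^2) set \<Rightarrow> (complex \<Rightarrow> 'b \<Rightarrow> mat2) \<Rightarrow> 'b \<Rightarrow> (complex^2) set" where
  "dressing_line \<alpha> L \<Phi> y = (\<lambda>v. matrix_inv (\<Phi> \<alpha> y) *v v) ` L"

definition dressing_factor ::
    "'b chart set \<Rightarrow> complex \<Rightarrow> (complex^2) set \<Rightarrow> (complex \<Rightarrow> 'b \<Rightarrow> mat2) \<Rightarrow>
     complex \<Rightarrow> 'b \<Rightarrow> mat2" where
  "dressing_factor \<B> \<alpha> L \<Phi> \<mu> y =
     simple_factor \<alpha> (dressing_line \<alpha> L \<Phi> y) (spinor_span \<B> (frame_form \<Phi>) y) \<mu>"

definition dressing_domain ::
    "'b set \<Rightarrow> 'b chart set \<Rightarrow> complex \<Rightarrow> (complex^2) set \<Rightarrow> (complex \<Rightarrow> 'b \<Rightarrow> mat2) \<Rightarrow> 'b set" where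
  "dressing_domain Y \<B> \<alpha> L \<Phi> =
     {y\<in>Y. is_line (spinor_span \<B> (frame_form \<Phi>) y) \<and>
           dressing_line \<alpha> L \<Phi> y \<noteq> spinor_span \<B> (frame_form \<Phi>) y}"

text \<open>
  \<open>g # \<Phi> = g \<Phi> h\<^sup>-\<^sup>1\<close>.  At \<open>\<mu> = \<alpha>\<close> the factor \<open>h\<close> is singular and the value is the one at the
  removable singularity.
\<close>

definition dressing ::
    "'b chart set \<Rightarrow> complex \<Rightarrow> (complex^2) set \<Rightarrow> (complex^2) set \<Rightarrow>
     (complex \<Rightarrow> 'b \<Rightarrow> mat2) \<Rightarrow> complex \<Rightarrow> 'b \<Rightarrow> mat2" where
  "dressing \<B> \<alpha> L K \<Phi> \<mu> y =
     (let \<Psi> = (\<lambda>\<nu>. simple_factor \<alpha> L K \<nu> ** \<Phi> \<nu> y ** matrix_inv (dressing_factor \<B> \<alpha> L \<Phi> \<nu> y))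
      in if \<mu> = \<alpha> then Lim (at \<alpha>) \<Psi> else \<Psi> \<mu>)"

definition is_eigenline :: "mat2 \<Rightarrow> (complex^2) set \<Rightarrow> bool" where
  "is_eigenline A L \<longleftrightarrow> is_line L \<and> (\<exists>k. \<forall>v\<in>L. A *v v = k *s v)"

end

theory Submission
  imports Defs "HOL-Complex_Analysis.Conformal_Mappings"
begin

text \<open>
  Away from \<open>\<mu> = \<alpha>\<close> the formula is a one line computation, provided that the factor \<open>h\<close> has the same
  value at \<open>\<tau> y\<close> and at \<open>y\<close>: then \<open>g \<Phi> h\<^sup>-\<^sup>1\<close> at \<open>\<tau> y\<close> is \<open>g M \<Phi> h\<^sup>-\<^sup>1 = (g M g\<^sup>-\<^sup>1) (g \<Phi> h\<^sup>-\<^sup>1)\<close>.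
  Now \<open>h\<close> is determined by two lines.  The first, \<open>\<Phi>\<^sub>\<alpha>\<^sup>-\<^sup>1 L\<close>, becomes \<open>\<Phi>\<^sub>\<alpha>\<^sup>-\<^sup>1 M\<^sub>\<alpha>\<^sup>-\<^sup>1 L\<close> at \<open>\<tau> y\<close>, which is the
  same line because \<open>L\<close> is an eigenline of \<open>M\<^sub>\<alpha>\<close>.  The second, the line of the spinor, can be read off
  from the potential at the base point \<open>p y = p (\<tau> y)\<close> (\<open>spinor_span_eq_base\<close>).  For this one needs
  that pulling back by the covering map multiplies the potential by a number that is not zero,
  which holds because an injective holomorphic function has no critical points.

  The value \<open>\<mu> = \<alpha>\<close>, where \<open>g\<close> and \<open>h\<close> are singular, is covered by one lemma,
  \<open>entire_simple_factor_conj\<close>: if \<open>F\<^sub>\<alpha>\<close> maps the first line of one simple factor into the first line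
  of another, then the quotient of the two around \<open>F\<close> extends to an entire function of \<open>\<mu>\<close>.
  In bases adapted to the lines, the only entry that acquires a denominator \<open>\<mu> - \<alpha>\<close> is the lower left
  one, and it vanishes at \<open>\<alpha>\<close>.  With \<open>F = M\<close> this gives the entire monodromy, and with \<open>F = \<Phi>\<close> it
  shows that the dressed frame is entire, so that identities extend from \<open>\<mu> \<noteq> \<alpha>\<close> to \<open>\<alpha>\<close> by continuity.

  The monodromy is unique because the dressed frame is invertible at every point of its domain and
  this domain is not empty.  The latter is where non-flatness enters: otherwise \<open>\<Phi>\<^sub>\<alpha> w\<close> would take
  its values in the fixed line \<open>L\<close>, so that \<open>\<Phi>\<^sub>\<alpha> w\<close> and its derivative would be linearly dependent
  (\<open>dressing_domain_nonempty\<close>).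
\<close>

section \<open>Two by two matrices and lines\<close>

lemma mat2_eq_iff:
  fixes A B :: "'a^2^2"
  shows "A = B \<longleftrightarrow> A$1$1 = B$1$1 \<and> A$1$2 = B$1$2 \<and> A$2$1 = B$2$1 \<and> A$2$2 = B$2$2"
  by (auto simp: vec_eq_iff forall_2)

lemma mat2_mult_nth:
  fixes A B :: mat2
  shows "(A ** B) $ i $ j = A$i$1 * B$1$j + A$i$2 * B$2$j"
  by (simp add: matrix_matrix_mult_def sum_2)

lemma mat2_vec_nth:
  fixes A :: mat2
  shows "(A *v x) $ i = A$i$1 * x$1 + A$i$2 * x$2"
  by (simp add: matrix_vector_mult_def sum_2)

lemma matrix_inv_cancel:
  fixes A :: mat2
  assumes "invertible A"
  shows "matrix_inv A ** A = mat 1" "A ** matrix_inv A = mat 1"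
proof -
  have "\<exists>B. A ** B = mat 1 \<and> B ** A = mat 1"
    using assms by (simp add: invertible_def)
  then have "A ** matrix_inv A = mat 1 \<and> matrix_inv A ** A = mat 1"
    unfolding matrix_inv_def by (rule someI_ex)
  then show "matrix_inv A ** A = mat 1" "A ** matrix_inv A = mat 1" by auto
qed

lemma invertible_matrix_inv: "invertible A \<Longrightarrow> invertible (matrix_inv A)" for A :: mat2
  using matrix_inv_cancel unfolding invertible_def by blast

lemma mat2_cancel_right:
  fixes A B C :: mat2
  assumes "A ** C = B ** C" "det C \<noteq> 0"
  shows "A = B"
proof -
  have "A ** C ** matrix_inv C = B ** C ** matrix_inv C" using assms by simp
  then show ?thesis using assms(2)
    by (simp add: matrix_mul_assoc[symmetric] matrix_inv_cancel invertible_det_nz)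
qed

lemma matrix_inv_mult:
  fixes A B :: mat2
  assumes "invertible A" "invertible B"
  shows "matrix_inv (A ** B) = matrix_inv B ** matrix_inv A"
proof -
  have inv: "invertible (A ** B)" using assms by (rule invertible_mult)
  have "matrix_inv B ** matrix_inv A ** (A ** B) = matrix_inv B ** (matrix_inv A ** A) ** B"
    by (simp add: matrix_mul_assoc)
  then have "matrix_inv (A ** B) ** (A ** B) = matrix_inv B ** matrix_inv A ** (A ** B)"
    using assms inv by (simp add: matrix_inv_cancel)
  then show ?thesis by (rule mat2_cancel_right) (use inv in \<open>simp add: invertible_det_nz\<close>)
qed

lemma span_singleton_scale:
  fixes v :: "complex^2"
  assumes "r \<noteq> 0"
  shows "vec.span {r *s v} = vec.span {v}"
proof
  show "vec.span {r *s v} \<subseteq> vec.span {v}"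
    by (auto simp: vec.span_singleton vector_smult_assoc)
  have "a *s v = (a / r) *s (r *s v)" for a using assms by (simp add: vector_smult_assoc)
  then show "vec.span {v} \<subseteq> vec.span {r *s v}"
    unfolding vec.span_singleton by blast
qed

lemma line_eq_span:
  assumes "is_line L" "v \<in> L" "v \<noteq> 0"
  shows "L = vec.span {v}"
proof -
  obtain u where u: "u \<noteq> 0" "L = vec.span {u}" using assms by (auto simp: is_line_def)
  then obtain k where k: "v = k *s u" using assms by (auto simp: vec.span_singleton)
  with assms have "k \<noteq> 0" by auto
  then show ?thesis by (simp add: u(2) k span_singleton_scale)
qed

lemma line_memD:
  assumes "is_line L" "v \<in> L" "v \<noteq> 0" "u \<in> L"
  obtains k where "u = k *s v"
  using line_eq_span[OF assms(1-3)] assms(4) by (auto simp: vec.span_singleton)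

lemma line_scale_mem: "is_line L \<Longrightarrow> v \<in> L \<Longrightarrow> k *s v \<in> L"
  by (auto simp: is_line_def vec.span_scale)

lemma line_not_parallel:
  assumes "is_line L" "is_line K" "L \<noteq> K" "v \<in> L" "u \<in> K" "v \<noteq> 0" "u \<noteq> 0"
  shows "v$1 * u$2 - u$1 * v$2 \<noteq> 0"
proof
  assume eq: "v$1 * u$2 - u$1 * v$2 = 0"
  have "\<exists>k. u = k *s v"
  proof (cases "v$1 = 0")
    case True
    with assms have "v$2 \<noteq> 0" by (auto simp: vec_eq_iff forall_2)
    with True eq show ?thesis
      by (intro exI[of _ "u$2 / v$2"]) (auto simp: vec_eq_iff forall_2)
  next
    case False
    with eq show ?thesis
      by (intro exI[of _ "u$1 / v$1"]) (auto simp: vec_eq_iff forall_2 field_simps)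
  qed
  then have "u \<in> L" using assms line_scale_mem by blast
  then show False using line_eq_span assms by metis
qed

lemma is_line_image:
  fixes A :: mat2
  assumes "is_line L" "invertible A"
  shows "is_line ((*v) A ` L)"
proof -
  obtain v where v: "v \<noteq> 0" "L = vec.span {v}" using assms by (auto simp: is_line_def)
  have "A *v v \<noteq> 0"
    by (metis assms(2) matrix_inv_cancel(1) matrix_vector_mul_assoc matrix_vector_mul_lid
          matrix_vector_mult_0_right v(1))
  moreover have "(*v) A ` L = vec.span {A *v v}"
    by (auto simp: v(2) vec.span_singleton image_image vector_scalar_commute)
  ultimately show ?thesis unfolding is_line_def by blast
qed

section \<open>Simple factors in adapted bases\<close>

definition diag1 :: "complex \<Rightarrow> mat2" where
  "diag1 t = vector [vector [t, 0], vector [0, 1]]"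

lemma diag1_nth [simp]: "diag1 t $ 1 $ 1 = t" "diag1 t $ 1 $ 2 = 0" "diag1 t $ 2 $ 1 = 0" "diag1 t $ 2 $ 2 = 1"
  by (simp_all add: diag1_def)

lemma det_diag1: "det (diag1 t) = t" by (simp add: det_2)

lemma matrix_inv_diag1:
  assumes "t \<noteq> 0" shows "matrix_inv (diag1 t) = diag1 (1/t)"
proof -
  have "diag1 (1/t) ** diag1 t = mat 1"
    using assms by (simp add: mat2_eq_iff mat2_mult_nth mat_def)
  moreover have "matrix_inv (diag1 t) ** diag1 t = mat 1"
    by (intro matrix_inv_cancel) (simp add: invertible_det_nz det_diag1 assms)
  ultimately show ?thesis using mat2_cancel_right[of _ "diag1 t"] assms det_diag1 by metis
qed

definition adapted :: "(complex^2) set \<Rightarrow> (complex^2) set \<Rightarrow> mat2 \<Rightarrow> bool" where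
  "adapted L K S \<longleftrightarrow> invertible S \<and> column 1 S \<in> L \<and> column 2 S \<in> K"

lemma adapted_exists:
  assumes "is_line L" "is_line K" "L \<noteq> K"
  obtains S where "adapted L K S"
proof -
  obtain v u where v: "v \<noteq> 0" "L = vec.span {v}" and u: "u \<noteq> 0" "K = vec.span {u}"
    using assms by (auto simp: is_line_def)
  then have mem: "v \<in> L" "u \<in> K" by (auto intro: vec.span_base)
  define S :: mat2 where "S = (\<chi> i j. if j = 1 then v$i else u$i)"
  have "column 1 S = v" "column 2 S = u" by (auto simp: S_def column_def vec_eq_iff)
  moreover have "det S \<noteq> 0" using line_not_parallel[OF assms mem v(1) u(1)]
    by (simp add: det_2 S_def)
  ultimately show ?thesis using that[of S] mem by (simp add: adapted_def invertible_det_nz)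
qed

lemma adapted_column_nonzero:
  assumes "adapted L K S" shows "column 1 S \<noteq> 0" "column 2 S \<noteq> 0"
  using assms by (auto simp: adapted_def invertible_det_nz det_2 column_def vec_eq_iff forall_2)

text \<open>
  Two adapted bases differ by a diagonal matrix on the right, which commutes with the diagonal matrix
  being conjugated.  Hence the definite description is met by exactly one function.
\<close>

lemma simple_factor_eq:
  assumes "is_line L" "is_line K" "adapted L K S"
  shows "simple_factor \<alpha> L K \<mu> = S ** diag1 (\<mu> - \<alpha>) ** matrix_inv S"
proof -
  have "simple_factor \<alpha> L K = (\<lambda>\<mu>. S ** diag1 (\<mu> - \<alpha>) ** matrix_inv S)"
    unfolding simple_factor_def diag1_def[symmetric]
  proof (rule the_equality)
    show "\<exists>Sa. invertible Sa \<and> column 1 Sa \<in> L \<and> column 2 Sa \<in> K \<and>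
          (\<lambda>\<mu>. S ** diag1 (\<mu> - \<alpha>) ** matrix_inv S) = (\<lambda>\<mu>. Sa ** diag1 (\<mu> - \<alpha>) ** matrix_inv Sa)"
      using assms(3) by (auto simp: adapted_def)
  next
    fix G assume "\<exists>T. invertible T \<and> column 1 T \<in> L \<and> column 2 T \<in> K \<and>
          G = (\<lambda>\<mu>. T ** diag1 (\<mu> - \<alpha>) ** matrix_inv T)"
    then obtain T where T: "adapted L K T" and G: "G = (\<lambda>\<mu>. T ** diag1 (\<mu> - \<alpha>) ** matrix_inv T)"
      by (auto simp: adapted_def)
    obtain a where a: "column 1 T = a *s column 1 S"
      using line_memD[of L "column 1 S" "column 1 T"] assms T adapted_column_nonzero
      by (metis adapted_def)
    obtain b where b: "column 2 T = b *s column 2 S"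
      using line_memD[of K "column 2 S" "column 2 T"] assms T adapted_column_nonzero
      by (metis adapted_def)
    define E :: mat2 where "E = vector [vector [a, 0], vector [0, b]]"
    have TE: "T = S ** E"
      using a b by (auto simp: vec_eq_iff column_def forall_2 mat2_mult_nth E_def)
    have comm: "E ** diag1 t = diag1 t ** E" for t
      by (simp add: mat2_eq_iff mat2_mult_nth E_def)
    show "G = (\<lambda>\<mu>. S ** diag1 (\<mu> - \<alpha>) ** matrix_inv S)"
    proof
      fix \<mu>
      have "G \<mu> ** T = T ** diag1 (\<mu> - \<alpha>)"
        using T by (simp add: G adapted_def matrix_mul_assoc[symmetric] matrix_inv_cancel)
      also have "\<dots> = S ** diag1 (\<mu> - \<alpha>) ** E"
        by (simp add: TE matrix_mul_assoc[symmetric] comm)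
      also have "\<dots> = S ** diag1 (\<mu> - \<alpha>) ** (matrix_inv S ** S) ** E"
        using assms by (simp add: adapted_def matrix_inv_cancel)
      also have "\<dots> = S ** diag1 (\<mu> - \<alpha>) ** matrix_inv S ** T"
        by (simp add: TE matrix_mul_assoc)
      finally show "G \<mu> = S ** diag1 (\<mu> - \<alpha>) ** matrix_inv S"
        by (rule mat2_cancel_right) (use T in \<open>simp add: adapted_def invertible_det_nz\<close>)
    qed
  qed
  then show ?thesis by simp
qed

section \<open>Removing the singularity at the parameter of a simple factor\<close>

definition entire :: "(complex \<Rightarrow> mat2) \<Rightarrow> bool" where
  "entire F \<longleftrightarrow> (\<forall>i j. (\<lambda>\<mu>. F \<mu> $ i $ j) holomorphic_on UNIV)"

lemma entire_const: "entire (\<lambda>_. C)"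
  by (simp add: entire_def)

lemma entire_mult: "entire F \<Longrightarrow> entire G \<Longrightarrow> entire (\<lambda>\<mu>. F \<mu> ** G \<mu>)"
  by (auto simp: entire_def mat2_mult_nth intro!: holomorphic_intros)

lemma entire_tendsto:
  assumes "entire F" shows "(F \<longlongrightarrow> F \<alpha>) (at \<alpha>)"
proof (intro vec_tendstoI)
  fix i j
  have "isCont (\<lambda>\<mu>. F \<mu> $ i $ j) \<alpha>"
    using assms holomorphic_on_imp_continuous_on continuous_on_eq_continuous_at[OF open_UNIV]
    unfolding entire_def by blast
  then show "((\<lambda>\<mu>. F \<mu> $ i $ j) \<longlongrightarrow> F \<alpha> $ i $ j) (at \<alpha>)" by (simp add: isCont_def)
qed

lemma entire_eqI:
  assumes "entire F" "entire G" "\<And>\<mu>. \<mu> \<noteq> \<alpha> \<Longrightarrow> F \<mu> = G \<mu>"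
  shows "F = G"
proof -
  have "(F \<longlongrightarrow> G \<alpha>) (at \<alpha>)"
    by (rule Lim_transform_eventually[OF entire_tendsto[OF assms(2)]])
       (simp add: eventually_at_filter assms(3))
  then have "F \<alpha> = G \<alpha>" using entire_tendsto[OF assms(1)] LIM_unique by blast
  then show ?thesis using assms(3) by (metis ext)
qed

text \<open>
  Conjugation multiplies the upper right entry by \<open>\<mu> - \<alpha>\<close> and divides the lower left one by it;
  the hypothesis turns the latter into a difference quotient, with a removable singularity.
\<close>

lemma entire_diag1_conj:
  assumes P: "entire P" and "P \<alpha> $ 2 $ 1 = 0"
  obtains E where "entire E" "\<And>\<mu>. det (E \<mu>) = det (P \<mu>)"
     "\<And>\<mu>. \<mu> \<noteq> \<alpha> \<Longrightarrow> E \<mu> = diag1 (\<mu> - \<alpha>) ** P \<mu> ** matrix_inv (diag1 (\<mu> - \<alpha>))"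
proof -
  define f where "f = (\<lambda>\<mu>. P \<mu> $ 2 $ 1)"
  \<comment> \<open>\<open>q\<close> is the lower left entry divided by \<open>\<mu> - \<alpha>\<close>, entire by Riemann's theorem\<close>
  define q where "q = (\<lambda>\<mu>. if \<mu> = \<alpha> then deriv f \<alpha> else (f \<mu> - f \<alpha>) / (\<mu> - \<alpha>))"
  have f: "f holomorphic_on UNIV" using P by (simp add: f_def entire_def)
  have q: "q holomorphic_on UNIV" unfolding q_def by (rule pole_lemma[OF f]) simp
  have f0: "f \<alpha> = 0" using assms by (simp add: f_def)
  have fq: "f \<mu> = (\<mu> - \<alpha>) * q \<mu>" for \<mu> by (simp add: q_def f0)
  define E :: "complex \<Rightarrow> mat2" where
    "E = (\<lambda>\<mu>. vector [vector [P \<mu> $ 1 $ 1, (\<mu> - \<alpha>) * P \<mu> $ 1 $ 2], vector [q \<mu>, P \<mu> $ 2 $ 2]])"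
  show ?thesis
  proof
    show "entire E" using P q by (auto simp: entire_def E_def forall_2 intro!: holomorphic_intros)
    show "det (E \<mu>) = det (P \<mu>)" for \<mu>
      using fq[of \<mu>] by (simp add: det_2 E_def f_def)
    show "E \<mu> = diag1 (\<mu> - \<alpha>) ** P \<mu> ** matrix_inv (diag1 (\<mu> - \<alpha>))" if "\<mu> \<noteq> \<alpha>" for \<mu>
      using that fq[of \<mu>]
      by (simp add: matrix_inv_diag1 mat2_eq_iff mat2_mult_nth E_def f_def)
  qed
qed

text \<open>
  Passing to adapted bases reduces this to the diagonal case: the condition that \<open>F\<^sub>\<alpha>\<close> maps \<open>L'\<close>
  into \<open>L\<close> says that the lower left entry of the transformed matrix vanishes at \<open>\<alpha>\<close>.
  Both simple factors have determinant \<open>\<mu> - \<alpha>\<close>, so that the determinant of \<open>F\<close> is preserved.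
\<close>

lemma entire_simple_factor_conj:
  assumes L: "is_line L" "is_line K" "L \<noteq> K" and L': "is_line L'" "is_line K'" "L' \<noteq> K'"
    and F: "entire F" and map: "\<And>v. v \<in> L' \<Longrightarrow> F \<alpha> *v v \<in> L"
  obtains E where "entire E" "\<And>\<mu>. det (E \<mu>) = det (F \<mu>)"
    "\<And>\<mu>. \<mu> \<noteq> \<alpha> \<Longrightarrow> E \<mu> = simple_factor \<alpha> L K \<mu> ** F \<mu> ** matrix_inv (simple_factor \<alpha> L' K' \<mu>)"
proof -
  obtain S where S: "adapted L K S" using adapted_exists L by blast
  obtain T where T: "adapted L' K' T" using adapted_exists L' by blast
  have inv: "invertible S" "invertible T" using S T by (auto simp: adapted_def)
  then have invi: "invertible (matrix_inv T)" by (blast intro: invertible_matrix_inv)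
  define P where "P = (\<lambda>\<mu>. matrix_inv S ** F \<mu> ** T)"
  have P: "entire P" unfolding P_def by (intro entire_mult entire_const F)
  have SP: "S ** P \<mu> = F \<mu> ** T" for \<mu>
    using inv by (simp add: P_def matrix_mul_assoc matrix_inv_cancel)
  have "F \<alpha> *v column 1 T \<in> L" using map T by (auto simp: adapted_def)
  then obtain k where k: "F \<alpha> *v column 1 T = k *s column 1 S"
    using line_memD[OF L(1)] S adapted_column_nonzero(1)[OF S] by (metis adapted_def)
  have col: "column 1 (A ** B) = A *v column 1 B" for A B :: mat2
    by (simp add: vec_eq_iff column_def mat2_vec_nth mat2_mult_nth)
  have "column 1 (P \<alpha>) = k *s column 1 (matrix_inv S ** S)"
    by (simp add: P_def col k vector_scalar_commute matrix_vector_mul_assoc[symmetric])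
  also have "\<dots> = k *s column 1 (mat 1)" using inv by (simp add: matrix_inv_cancel)
  finally have "P \<alpha> $ 2 $ 1 = 0"
    by (simp add: vec_eq_iff column_def forall_2 mat_def)
  then obtain E where E: "entire E" "\<And>\<mu>. det (E \<mu>) = det (P \<mu>)"
     "\<And>\<mu>. \<mu> \<noteq> \<alpha> \<Longrightarrow> E \<mu> = diag1 (\<mu> - \<alpha>) ** P \<mu> ** matrix_inv (diag1 (\<mu> - \<alpha>))"
    using entire_diag1_conj[OF P] by metis
  show ?thesis
  proof
    show "entire (\<lambda>\<mu>. S ** E \<mu> ** matrix_inv T)" by (intro entire_mult entire_const E)
    show "det (S ** E \<mu> ** matrix_inv T) = det (F \<mu>)" for \<mu>
    proof -
      have "det (S ** E \<mu> ** matrix_inv T) = det (S ** P \<mu>) * det (matrix_inv T)"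
        by (simp add: det_mul E)
      also have "\<dots> = det (F \<mu>) * det (T ** matrix_inv T)"
        by (simp add: SP det_mul)
      finally show ?thesis using inv by (simp add: matrix_inv_cancel)
    qed
    show "S ** E \<mu> ** matrix_inv T =
        simple_factor \<alpha> L K \<mu> ** F \<mu> ** matrix_inv (simple_factor \<alpha> L' K' \<mu>)" if "\<mu> \<noteq> \<alpha>" for \<mu>
    proof -
      let ?D = "diag1 (\<mu> - \<alpha>)"
      have D: "invertible ?D" using that by (simp add: invertible_det_nz det_diag1)
      have "matrix_inv (T ** ?D ** matrix_inv T) = matrix_inv (matrix_inv T) ** matrix_inv ?D ** matrix_inv T"
        by (simp add: matrix_inv_mult D inv invi invertible_mult matrix_mul_assoc)
      also have "matrix_inv (matrix_inv T) = T"
        by (rule mat2_cancel_right[of _ "matrix_inv T"])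
          (use inv invi in \<open>simp_all add: matrix_inv_cancel invertible_det_nz[symmetric]\<close>)
      finally have "matrix_inv (simple_factor \<alpha> L' K' \<mu>) = T ** matrix_inv ?D ** matrix_inv T"
        using simple_factor_eq[OF L'(1,2) T] by simp
      then show ?thesis
        by (simp add: simple_factor_eq[OF L(1,2) S] E(3)[OF that] P_def matrix_mul_assoc)
    qed
  qed
qed

section \<open>Charts and the covering map\<close>

lemma chart_image_open:
  assumes "is_chart Y c" "openin (top_of_set Y) W" "W \<subseteq> chart_dom c"
  shows "open (coord c ` W)"
proof -
  have hom: "homeomorphism (chart_dom c) (coord c ` chart_dom c) (coord c) (chart_inv c)"
    and op: "open (coord c ` chart_dom c)" and "openin (top_of_set Y) (chart_dom c)"
    using assms by (auto simp: is_chart_def)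
  then have "openin (top_of_set (chart_dom c)) W"
    using assms openin_subset_trans openin_imp_subset by metis
  then have "openin (top_of_set (coord c ` chart_dom c)) (coord c ` W)"
    using homeomorphism_imp_open_map[OF hom] by blast
  then show ?thesis using op openin_open_trans by blast
qed

lemma chart_inv_coord:
  assumes "is_chart Y c" "y \<in> chart_dom c"
  shows "chart_inv c (coord c y) = y"
  using assms by (auto simp: is_chart_def homeomorphism_def)

lemma riemann_surface_chart:
  assumes "riemann_surface Y \<B>" "c \<in> \<B>"
  shows "is_chart Y c" "chart_dom c \<subseteq> Y"
  using assms by (auto simp: riemann_surface_def)

text \<open>
  A covering map is locally injective, and an injective holomorphic function has a derivative without
  zeros.
\<close>

lemma covering_chart_deriv_nonzero:
  assumes X: "riemann_surface X \<A>" and U: "universal_cover Y \<B> p X \<A>"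
    and c: "c \<in> \<B>" and d: "d \<in> \<A>" and y: "y \<in> chart_dom c" "p y \<in> chart_dom d"
  shows "chart_deriv c (coord d \<circ> p) y \<noteq> 0"
proof -
  have Y: "riemann_surface Y \<B>" and cov: "covering_space Y p X" and hol: "holomorphic_map Y \<B> X \<A> p"
    using U by (auto simp: universal_cover_def)
  note cc = riemann_surface_chart[OF Y c] and dd = riemann_surface_chart[OF X d]
  obtain T where T: "y \<in> T" "openin (top_of_set Y) T" "inj_on p T"
  proof -
    have "y \<in> Y" using y cc by auto
    then obtain T u q where "y \<in> T" "openin (top_of_set Y) T" "homeomorphism T u p q"
      using covering_space_local_homeomorphism[OF cov] by metis
    then show ?thesis using that by (metis homeomorphism_apply1 inj_on_inverseI)
  qed
  define W where "W = T \<inter> chart_dom c \<inter> (Y \<inter> p -` chart_dom d)"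
  have "openin (top_of_set Y) (Y \<inter> p -` chart_dom d)"
    using hol dd cov unfolding is_chart_def holomorphic_map_def
    by (meson continuous_openin_preimage image_subset_iff_funcset)
  then have W: "openin (top_of_set Y) W" using T cc by (auto simp: W_def is_chart_def)
  let ?f = "(coord d \<circ> p) \<circ> chart_inv c"
  have op: "open (coord c ` W)" by (rule chart_image_open[OF cc(1) W]) (auto simp: W_def)
  have "?f holomorphic_on coord c ` (chart_dom c \<inter> p -` chart_dom d)"
    using hol c d by (auto simp: holomorphic_map_def)
  then have f: "?f holomorphic_on coord c ` W"
    by (rule holomorphic_on_subset) (auto simp: W_def)
  have inj: "inj_on ?f (coord c ` W)"
  proof (rule inj_onI, clarify)
    fix u v assume uv: "u \<in> W" "v \<in> W" "?f (coord c u) = ?f (coord c v)"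
    then have "coord d (p u) = coord d (p v)"
      using chart_inv_coord[OF cc(1)] by (auto simp: W_def)
    then have "p u = p v" using uv chart_inv_coord[OF dd(1)] by (metis IntE W_def vimageE)
    then show "coord c u = coord c v" using uv T by (auto simp: W_def dest: inj_onD)
  qed
  have "coord c y \<in> coord c ` W" using y T cc by (auto simp: W_def)
  from holomorphic_injective_imp_regular[OF f op inj this]
  show ?thesis by (simp add: chart_deriv_def)
qed

section \<open>The spinor line depends only on the base point\<close>

lemma spinor_value_iff:
  "spinor_value A w \<longleftrightarrow> A$1$1 = - (w$1 * w$2) \<and> A$1$2 = w$1 * w$1 \<and>
     A$2$1 = - (w$2 * w$2) \<and> A$2$2 = w$1 * w$2"
  by (auto simp: spinor_value_def mat2_eq_iff)

lemma mat_mult_nth: "(mat k ** A :: mat2) $ i $ j = k * A $ i $ j"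
  using exhaust_2[of i] by (auto simp: mat2_mult_nth mat_def)

text \<open>
  The part of \<open>spinor_span\<close> that belongs to a single coefficient matrix.  It allows the comparison of
  matrices that live on different surfaces and in different charts.
\<close>

definition spinor_lines :: "mat2 \<Rightarrow> (complex^2) set" where
  "spinor_lines A = \<Union> {vec.span {w} | w. spinor_value A w}"

lemma spinor_value_unique:
  assumes "spinor_value A w" "spinor_value A v"
  shows "v = w \<or> v = - w"
proof -
  have *: "v$1 * v$1 = w$1 * w$1" "v$2 * v$2 = w$2 * w$2" "v$1 * v$2 = w$1 * w$2"
    using assms by (auto simp: spinor_value_iff)
  then have "v$1 = w$1 \<or> v$1 = - w$1" "v$2 = w$2 \<or> v$2 = - w$2"
    by (metis square_eq_iff)+
  with * show ?thesis by (auto simp: vec_eq_iff forall_2)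
qed

lemma spinor_lines_eq:
  assumes "spinor_value A w"
  shows "spinor_lines A = vec.span {w}"
proof -
  have "vec.span {- w} = vec.span {w}"
    using span_singleton_scale[of "-1" w] by simp
  then have "spinor_value A v \<Longrightarrow> vec.span {v} = vec.span {w}" for v
    using spinor_value_unique[OF assms, of v] by auto
  then show ?thesis using assms unfolding spinor_lines_def by blast
qed

text \<open>
  A spinor for \<open>k A\<close> arises from one for \<open>A\<close> by multiplication with a square root of \<open>k\<close>.
\<close>

lemma spinor_lines_scale_le:
  assumes "k \<noteq> 0"
  shows "spinor_lines A \<subseteq> spinor_lines (mat k ** A)"
proof -
  have "\<exists>v. spinor_value (mat k ** A) v \<and> vec.span {v} = vec.span {w}" if "spinor_value A w" for w
  proof (intro exI conjI)
    define r where "r = csqrt k"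
    have r: "k = r * r" "r \<noteq> 0" using assms by (auto simp: r_def power2_eq_square[symmetric])
    show "spinor_value (mat k ** A) (r *s w)"
      using that by (simp add: spinor_value_iff mat_mult_nth r mult.assoc)
    show "vec.span {r *s w} = vec.span {w}" by (rule span_singleton_scale[OF r(2)])
  qed
  then show ?thesis unfolding spinor_lines_def by blast
qed

lemma spinor_lines_scale:
  assumes "k \<noteq> 0"
  shows "spinor_lines (mat k ** A) = spinor_lines A"
proof
  have "mat (1/k) ** (mat k ** A) = A"
    using assms by (simp add: vec_eq_iff mat_mult_nth)
  then show "spinor_lines (mat k ** A) \<subseteq> spinor_lines A"
    using spinor_lines_scale_le[of "1/k" "mat k ** A"] assms by simp
qed (rule spinor_lines_scale_le[OF assms])

text \<open>
  The factor \<open>k\<close> is the derivative of the covering map in the charts \<open>c\<close> and \<open>d\<close>.  It is the same for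
  all \<open>\<mu>\<close>, so that the coefficient of \<open>\<mu>\<close> is rescaled by it as well.
\<close>

lemma lambda_coeff_frame_form:
  assumes X: "riemann_surface X \<A>" and U: "universal_cover Y \<B> p X \<A>"
    and F: "lwr_frame Y \<B> p \<A> \<xi> \<Phi>"
    and c: "c \<in> \<B>" "y \<in> chart_dom c" and d: "d \<in> \<A>" "p y \<in> chart_dom d"
  obtains k where "k \<noteq> 0" "\<And>\<mu>. frame_form \<Phi> \<mu> c y = mat k ** \<xi> \<mu> d (p y)"
    "lambda_coeff (frame_form \<Phi>) c y = mat k ** lambda_coeff \<xi> d (p y)"
proof
  let ?k = "chart_deriv c (coord d \<circ> p) y"
  show "?k \<noteq> 0" using covering_chart_deriv_nonzero[OF X U c(1) d(1) c(2) d(2)] .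
  show *: "frame_form \<Phi> \<mu> c y = mat ?k ** \<xi> \<mu> d (p y)" for \<mu>
    using F c d by (auto simp: lwr_frame_def is_pullback_def)
  show "lambda_coeff (frame_form \<Phi>) c y = mat ?k ** lambda_coeff \<xi> d (p y)"
    by (simp add: lambda_coeff_def * vec_eq_iff mat_mult_nth algebra_simps)
qed

text \<open>
  The right-hand side involves \<open>y\<close> only through \<open>p y\<close>; this is what makes the line of the spinor
  invariant under deck transformations.
\<close>

lemma spinor_span_eq_base:
  assumes X: "riemann_surface X \<A>" and U: "universal_cover Y \<B> p X \<A>"
    and F: "lwr_frame Y \<B> p \<A> \<xi> \<Phi>"
    and y: "y \<in> Y" and d: "d \<in> \<A>" "p y \<in> chart_dom d"
  shows "spinor_span \<B> (frame_form \<Phi>) y = spinor_lines (lambda_coeff \<xi> d (p y))"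
proof -
  have *: "spinor_lines (lambda_coeff (frame_form \<Phi>) c y) = spinor_lines (lambda_coeff \<xi> d (p y))"
    if "c \<in> \<B>" "y \<in> chart_dom c" for c
    using lambda_coeff_frame_form[OF X U F that d] spinor_lines_scale by metis
  have "\<exists>c\<in>\<B>. y \<in> chart_dom c"
    using U y by (auto simp: universal_cover_def riemann_surface_def)
  moreover have "spinor_span \<B> (frame_form \<Phi>) y =
      (\<Union>c\<in>{c\<in>\<B>. y \<in> chart_dom c}. spinor_lines (lambda_coeff (frame_form \<Phi>) c y))"
    unfolding spinor_span_def spinor_lines_def by blast
  ultimately show ?thesis using * by auto
qed


lemma spinor_span_eq_span:
  assumes X: "riemann_surface X \<A>" and U: "universal_cover Y \<B> p X \<A>"
    and F: "lwr_frame Y \<B> p \<A> \<xi> \<Phi>"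
    and c: "c \<in> \<B>" "y \<in> chart_dom c" and w: "spinor_value (lambda_coeff (frame_form \<Phi>) c y) w"
  shows "spinor_span \<B> (frame_form \<Phi>) y = vec.span {w}"
proof -
  have "riemann_surface Y \<B>" using U by (auto simp: universal_cover_def)
  then have y: "y \<in> Y" using riemann_surface_chart(2) c by blast
  then have "p y \<in> X" using U by (auto simp: universal_cover_def covering_space_def)
  then obtain d where d: "d \<in> \<A>" "p y \<in> chart_dom d"
    using X by (auto simp: riemann_surface_def)
  have "spinor_lines (lambda_coeff (frame_form \<Phi>) c y) = spinor_lines (lambda_coeff \<xi> d (p y))"
    using lambda_coeff_frame_form[OF X U F c d] spinor_lines_scale by metis
  then show ?thesis using spinor_span_eq_base[OF X U F y d] spinor_lines_eq[OF w] by simp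
qed

section \<open>Non-flatness and the domain of the dressing\<close>

lemma hol_in_chart_has_deriv:
  assumes "is_chart Y c" "openin (top_of_set Y) V" "V \<subseteq> chart_dom c" "y \<in> V" "hol_in_chart c V f"
  shows "(f \<circ> chart_inv c has_field_derivative chart_deriv c f y) (at (coord c y))"
  using assms chart_image_open[OF assms(1-3)] holomorphic_derivI
  unfolding hol_in_chart_def chart_deriv_def by blast

lemma hol_in_chart_subset:
  assumes "hol_in_chart c V f" "W \<subseteq> V"
  shows "hol_in_chart c W f"
  using assms unfolding hol_in_chart_def by (meson holomorphic_on_subset image_mono)

lemma hol_in_chart_matrix_vector:
  fixes \<Phi> :: "'a \<Rightarrow> mat2"
  assumes "\<And>j. hol_in_chart c V (\<lambda>x. \<Phi> x $ i $ j)" "\<And>j. hol_in_chart c V (\<lambda>x. w x $ j)"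
  shows "hol_in_chart c V (\<lambda>x. (\<Phi> x *v w x) $ i)"
  using assms unfolding hol_in_chart_def o_def
  by (simp only: mat2_vec_nth) (intro holomorphic_intros; blast)

lemma frame_derivative:
  fixes \<Phi> :: "'b::topological_space \<Rightarrow> mat2"
  assumes c: "is_chart Y c" and V: "openin (top_of_set Y) V" "V \<subseteq> chart_dom c" "y \<in> V"
    and \<Phi>: "\<And>i j. hol_in_chart c V (\<lambda>x. \<Phi> x $ i $ j)"
    and w: "\<And>i. hol_in_chart c V (\<lambda>x. w x $ i)" and inv: "invertible (\<Phi> y)"
  shows "(\<chi> i. chart_deriv c (\<lambda>x. (\<Phi> x *v w x) $ i) y) =
      \<Phi> y *v ((matrix_inv (\<Phi> y) ** (\<chi> i j. chart_deriv c (\<lambda>x. \<Phi> x $ i $ j) y)) *v w y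
        + (\<chi> i. chart_deriv c (\<lambda>x. w x $ i) y))"
proof -
  have cy: "chart_inv c (coord c y) = y" using chart_inv_coord[OF c] V by auto
  note d\<Phi> = hol_in_chart_has_deriv[OF c V \<Phi>] and dw = hol_in_chart_has_deriv[OF c V w]
  have "chart_deriv c (\<lambda>x. (\<Phi> x *v w x) $ i) y =
     chart_deriv c (\<lambda>x. \<Phi> x $ i $ 1) y * w y $ 1 + \<Phi> y $ i $ 1 * chart_deriv c (\<lambda>x. w x $ 1) y
   + (chart_deriv c (\<lambda>x. \<Phi> x $ i $ 2) y * w y $ 2 + \<Phi> y $ i $ 2 * chart_deriv c (\<lambda>x. w x $ 2) y)"
    (is "_ = ?D") for i
  proof -
    have "((\<lambda>x. (\<Phi> x *v w x) $ i) \<circ> chart_inv c has_field_derivative ?D) (at (coord c y))"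
      using DERIV_add[OF DERIV_mult[OF d\<Phi> dw] DERIV_mult[OF d\<Phi> dw], of i 1 1 i 2 2]
      by (simp add: mat2_vec_nth o_def cy ac_simps)
    then show ?thesis by (simp add: chart_deriv_def DERIV_imp_deriv)
  qed
  then have "(\<chi> i. chart_deriv c (\<lambda>x. (\<Phi> x *v w x) $ i) y) =
      (\<chi> i j. chart_deriv c (\<lambda>x. \<Phi> x $ i $ j) y) *v w y + \<Phi> y *v (\<chi> i. chart_deriv c (\<lambda>x. w x $ i) y)"
    by (simp add: vec_eq_iff mat2_vec_nth algebra_simps)
  also have "\<dots> = (\<Phi> y ** matrix_inv (\<Phi> y) ** (\<chi> i j. chart_deriv c (\<lambda>x. \<Phi> x $ i $ j) y)) *v w y
      + \<Phi> y *v (\<chi> i. chart_deriv c (\<lambda>x. w x $ i) y)"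
    using inv by (simp add: matrix_inv_cancel)
  finally show ?thesis
    by (simp add: matrix_vector_mul_assoc matrix_mul_assoc matrix_vector_right_distrib)
qed

definition wronskian :: "'b chart \<Rightarrow> ('b \<Rightarrow> complex^2) \<Rightarrow> 'b \<Rightarrow> complex" where
  "wronskian c f y = det (transpose (vector [f y, \<chi> i. chart_deriv c (\<lambda>x. f x $ i) y] :: mat2))"

text \<open>
  A linear functional that vanishes on the line annihilates \<open>f\<close> and hence also its derivative, so
  that both columns of the determinant lie in the line.
\<close>

lemma wronskian_zero_in_line:
  assumes c: "is_chart Y c" and V: "openin (top_of_set Y) V" "V \<subseteq> chart_dom c" "y \<in> V"
    and f: "\<And>i. hol_in_chart c V (\<lambda>x. f x $ i)"
    and L: "is_line L" "\<And>x. x \<in> V \<Longrightarrow> f x \<in> L"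
  shows "wronskian c f y = 0"
proof -
  obtain v where v: "v \<noteq> 0" "L = vec.span {v}" using L by (auto simp: is_line_def)
  have lin: "v $ 1 * f x $ 2 = v $ 2 * f x $ 1" if "x \<in> V" for x
    using L(2)[OF that] by (auto simp: v vec.span_singleton)
  note df = hol_in_chart_has_deriv[OF c V f]
  let ?a = "chart_deriv c (\<lambda>x. f x $ 1) y" and ?b = "chart_deriv c (\<lambda>x. f x $ 2) y"
  have "v $ 1 * ?b = v $ 2 * ?a"
  proof (rule DERIV_unique)
    show "((\<lambda>z. v $ 1 * ((\<lambda>x. f x $ 2) \<circ> chart_inv c) z) has_field_derivative
        v $ 1 * ?b) (at (coord c y))"
      by (rule DERIV_cmult[OF df])
    have "((\<lambda>z. v $ 2 * ((\<lambda>x. f x $ 1) \<circ> chart_inv c) z) has_field_derivative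
        v $ 2 * ?a) (at (coord c y))"
      by (rule DERIV_cmult[OF df])
    then show "((\<lambda>z. v $ 1 * ((\<lambda>x. f x $ 2) \<circ> chart_inv c) z) has_field_derivative
        v $ 2 * ?a) (at (coord c y))"
    proof (rule has_field_derivative_transform_within_open[OF _ chart_image_open[OF c V(1,2)]])
      fix z assume "z \<in> coord c ` V"
      then have "chart_inv c z \<in> V" using chart_inv_coord[OF c] V by auto
      then show "v $ 2 * ((\<lambda>x. f x $ 1) \<circ> chart_inv c) z = v $ 1 * ((\<lambda>x. f x $ 2) \<circ> chart_inv c) z"
        using lin by simp
    qed (use V in auto)
  qed
  then have "v $ 1 * (f y $ 1 * ?b - ?a * f y $ 2) = 0" "v $ 2 * (f y $ 1 * ?b - ?a * f y $ 2) = 0"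
    using lin[OF V(3)] by algebra+
  then have "f y $ 1 * ?b - ?a * f y $ 2 = 0" using v(1) by (auto simp: vec_eq_iff forall_2)
  then show ?thesis by (simp add: wronskian_def det_2 transpose_def)
qed

lemma det_columns_mult:
  fixes A :: mat2
  assumes "det A = 1"
  shows "det (transpose (vector [A *v u, A *v v] :: mat2)) = u$1 * v$2 - v$1 * u$2"
proof -
  have "det (transpose (vector [A *v u, A *v v] :: mat2)) = det A * (u$1 * v$2 - v$1 * u$2)"
    by (simp add: det_2 transpose_def mat2_vec_nth algebra_simps)
  then show ?thesis using assms by simp
qed

text \<open>
  Since \<open>A w = 0\<close>, the derivative of \<open>\<Phi> w\<close> is \<open>\<Phi> ((\<mu> A + B) w + w') = \<Phi> (B w + w')\<close>.  As \<open>det \<Phi> = 1\<close>, the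
  determinant equals \<open>det (w, B w + w')\<close>, from which \<open>\<mu>\<close> has disappeared.
\<close>

lemma frame_wronskian_const:
  assumes X: "riemann_surface X \<A>" and U: "universal_cover Y \<B> p X \<A>"
    and \<xi>: "lwr_potential \<A> \<xi>" and F: "lwr_frame Y \<B> p \<A> \<xi> \<Phi>"
    and c: "c \<in> \<B>" and sp: "local_spinor Y (frame_form \<Phi>) c V w" and y: "y \<in> V"
  shows "wronskian c (\<lambda>x. \<Phi> \<mu> x *v w x) y = wronskian c (\<lambda>x. \<Phi> \<nu> x *v w x) y"
proof -
  have Y: "riemann_surface Y \<B>" using U by (auto simp: universal_cover_def)
  note cc = riemann_surface_chart[OF Y c]
  have V: "openin (top_of_set Y) V" "V \<subseteq> chart_dom c" and w: "\<And>i. hol_in_chart c V (\<lambda>x. w x $ i)"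
    and spv: "spinor_value (lambda_coeff (frame_form \<Phi>) c y) (w y)"
    using sp y by (auto simp: local_spinor_def)
  have yc: "y \<in> chart_dom c" "y \<in> Y" using V cc y by auto
  have det1: "det (\<Phi> \<mu> y) = 1" for \<mu> using F yc by (auto simp: lwr_frame_def)
  have hol: "hol_in_chart c V (\<lambda>x. \<Phi> \<mu> x $ i $ j)" for \<mu> i j
    by (rule hol_in_chart_subset[OF _ V(2)]) (use F c in \<open>simp add: lwr_frame_def\<close>)
  define w' where "w' = (\<chi> i. chart_deriv c (\<lambda>x. w x $ i) y)"
  have deriv: "(\<chi> i. chart_deriv c (\<lambda>x. (\<Phi> \<mu> x *v w x) $ i) y) =
      \<Phi> \<mu> y *v (frame_form \<Phi> \<mu> c y *v w y + w')" for \<mu>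
    unfolding w'_def frame_form_def
    by (rule frame_derivative[OF cc(1) V y hol w]) (simp add: invertible_det_nz det1)
  have indep: "frame_form \<Phi> \<mu> c y *v w y = frame_form \<Phi> 0 c y *v w y" for \<mu>
  proof -
    have "p y \<in> X" using U yc by (auto simp: universal_cover_def covering_space_def)
    then obtain d where d: "d \<in> \<A>" "p y \<in> chart_dom d"
      using X by (auto simp: riemann_surface_def)
    from lambda_coeff_frame_form[OF X U F c yc(1) d] obtain k where
      k: "\<And>\<mu>. frame_form \<Phi> \<mu> c y = mat k ** \<xi> \<mu> d (p y)" by metis
    obtain A B where AB: "\<And>\<mu>. \<xi> \<mu> d (p y) = mat \<mu> ** A (p y) + B (p y)"
      using \<xi> d unfolding lwr_potential_def by metis
    have lin: "frame_form \<Phi> \<mu> c y = mat \<mu> ** lambda_coeff (frame_form \<Phi>) c y + frame_form \<Phi> 0 c y"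
      by (simp add: lambda_coeff_def k AB vec_eq_iff mat_mult_nth algebra_simps)
    \<comment> \<open>the row \<open>(-b a)\<close> of \<open>A\<close> annihilates the column \<open>w = (a, b)\<close>\<close>
    have "(mat \<mu> ** lambda_coeff (frame_form \<Phi>) c y) *v w y = 0"
      using spv by (simp add: spinor_value_iff vec_eq_iff forall_2 mat2_vec_nth mat_mult_nth)
    then show ?thesis by (simp add: lin matrix_vector_mult_add_rdistrib)
  qed
  have "wronskian c (\<lambda>x. \<Phi> \<mu> x *v w x) y
      = w y $ 1 * (frame_form \<Phi> 0 c y *v w y + w') $ 2
        - (frame_form \<Phi> 0 c y *v w y + w') $ 1 * w y $ 2" for \<mu>
    unfolding wronskian_def deriv indep[of \<mu>] by (rule det_columns_mult[OF det1])
  then show ?thesis by metis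
qed

text \<open>
  If the domain is empty, then wherever \<open>w \<noteq> 0\<close> the line of \<open>w\<close> equals \<open>\<Phi>\<^sub>\<alpha>\<^sup>-\<^sup>1 L\<close>, so that \<open>\<Phi>\<^sub>\<alpha> w\<close> lies in
  \<open>L\<close> throughout and its determinant with its derivative vanishes at the parameter \<open>\<alpha>\<close>.  By
  \<open>frame_wronskian_const\<close> it then vanishes at all parameters, contrary to non-flatness.
\<close>

lemma dressing_domain_nonempty:
  assumes X: "riemann_surface X \<A>" and U: "universal_cover Y \<B> p X \<A>"
    and \<xi>: "lwr_potential \<A> \<xi>"
    and F: "lwr_frame Y \<B> p \<A> \<xi> \<Phi>" and nf: "non_flat Y \<B> \<Phi>" and L: "is_line L"
  shows "dressing_domain Y \<B> \<alpha> L \<Phi> \<noteq> {}"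
proof
  assume empty: "dressing_domain Y \<B> \<alpha> L \<Phi> = {}"
  have Y: "riemann_surface Y \<B>" using U by (auto simp: universal_cover_def)
  obtain c V w y \<mu> where c: "c \<in> \<B>" and sp: "local_spinor Y (frame_form \<Phi>) c V w" and yV: "y \<in> V"
    and nz: "wronskian c (\<lambda>x. \<Phi> \<mu> x *v w x) y \<noteq> 0"
    using nf unfolding non_flat_def wronskian_def by blast
  note cc = riemann_surface_chart[OF Y c]
  have V: "openin (top_of_set Y) V" "V \<subseteq> chart_dom c" and w: "\<And>i. hol_in_chart c V (\<lambda>x. w x $ i)"
    and spv: "\<And>x. x \<in> V \<Longrightarrow> spinor_value (lambda_coeff (frame_form \<Phi>) c x) (w x)"
    using sp by (auto simp: local_spinor_def)
  have hol: "hol_in_chart c V (\<lambda>x. \<Phi> \<alpha> x $ i $ j)" for i j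
    by (rule hol_in_chart_subset[OF _ V(2)]) (use F c in \<open>simp add: lwr_frame_def\<close>)
  have in_L: "\<Phi> \<alpha> x *v w x \<in> L" if x: "x \<in> V" for x
  proof (cases "w x = 0")
    case True
    then show ?thesis using L by (auto simp: is_line_def vec.span_zero)
  next
    case False
    have xY: "x \<in> chart_dom c" "x \<in> Y" using V cc x by auto
    have inv: "invertible (\<Phi> \<alpha> x)" using F xY by (auto simp: lwr_frame_def invertible_det_nz)
    have span: "spinor_span \<B> (frame_form \<Phi>) x = vec.span {w x}"
      by (rule spinor_span_eq_span[OF X U F c xY(1) spv[OF x]])
    then have "is_line (spinor_span \<B> (frame_form \<Phi>) x)" using False by (auto simp: is_line_def)
    then have "dressing_line \<alpha> L \<Phi> x = vec.span {w x}"
      using empty xY span unfolding dressing_domain_def by blast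
    then have "w x \<in> (\<lambda>v. matrix_inv (\<Phi> \<alpha> x) *v v) ` L"
      using vec.span_base[of "w x" "{w x}"] by (simp add: dressing_line_def)
    then show ?thesis
      using inv by (auto simp: matrix_vector_mul_assoc matrix_inv_cancel)
  qed
  have "wronskian c (\<lambda>x. \<Phi> \<alpha> x *v w x) y = 0"
    by (rule wronskian_zero_in_line[OF cc(1) V yV hol_in_chart_matrix_vector[OF hol w] L in_L])
  also have "wronskian c (\<lambda>x. \<Phi> \<alpha> x *v w x) y = wronskian c (\<lambda>x. \<Phi> \<mu> x *v w x) y"
    by (rule frame_wronskian_const[OF X U \<xi> F c sp yV])
  finally show False using nz by contradiction
qed

section \<open>The dressed frame and its monodromy\<close>

text \<open>
  The factor \<open>h\<close> is built from the line \<open>\<Phi>\<^sub>\<alpha>\<^sup>-\<^sup>1 L\<close> precisely so that \<open>\<Phi>\<^sub>\<alpha>\<close> maps its first line into \<open>L\<close>,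
  the first line of \<open>g\<close>.  The limit in the definition of \<open>dressing\<close> is then the value at \<open>\<alpha>\<close> of the
  entire extension.
\<close>

lemma dressing_entire:
  assumes F: "lwr_frame Y \<B> p \<A> \<xi> \<Phi>" and L: "is_line L" "is_line K" "L \<noteq> K"
    and y: "y \<in> dressing_domain Y \<B> \<alpha> L \<Phi>"
  shows "entire (\<lambda>\<mu>. dressing \<B> \<alpha> L K \<Phi> \<mu> y)" "det (dressing \<B> \<alpha> L K \<Phi> \<mu> y) = 1"
proof -
  let ?L = "dressing_line \<alpha> L \<Phi> y" and ?K = "spinor_span \<B> (frame_form \<Phi>) y"
  have yY: "y \<in> Y" using y by (auto simp: dressing_domain_def)
  have det1: "det (\<Phi> \<nu> y) = 1" for \<nu> using F yY by (auto simp: lwr_frame_def)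
  then have inv: "invertible (\<Phi> \<nu> y)" for \<nu> by (simp add: invertible_det_nz)
  then have "invertible (matrix_inv (\<Phi> \<alpha> y))" by (rule invertible_matrix_inv)
  then have L': "is_line ?L" "is_line ?K" "?L \<noteq> ?K"
    using y is_line_image[OF L(1)] by (auto simp: dressing_domain_def dressing_line_def)
  have ent: "entire (\<lambda>\<nu>. \<Phi> \<nu> y)" using F yY by (auto simp: lwr_frame_def entire_def)
  have map: "\<Phi> \<alpha> y *v v \<in> L" if "v \<in> ?L" for v
    using that inv by (auto simp: dressing_line_def matrix_vector_mul_assoc matrix_inv_cancel)
  obtain E where E: "entire E" "\<And>\<mu>. det (E \<mu>) = det (\<Phi> \<mu> y)"
    "\<And>\<mu>. \<mu> \<noteq> \<alpha> \<Longrightarrow> E \<mu> = simple_factor \<alpha> L K \<mu> ** \<Phi> \<mu> y ** matrix_inv (simple_factor \<alpha> ?L ?K \<mu>)"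
    using entire_simple_factor_conj[OF L L' ent map] by metis
  define \<Psi> where "\<Psi> = (\<lambda>\<nu>. simple_factor \<alpha> L K \<nu> ** \<Phi> \<nu> y ** matrix_inv (dressing_factor \<B> \<alpha> L \<Phi> \<nu> y))"
  have \<Psi>: "\<Psi> \<nu> = E \<nu>" if "\<nu> \<noteq> \<alpha>" for \<nu>
    using E(3)[OF that] by (simp add: \<Psi>_def dressing_factor_def)
  have "(\<Psi> \<longlongrightarrow> E \<alpha>) (at \<alpha>)"
    by (rule Lim_transform_eventually[OF entire_tendsto[OF E(1)]])
       (simp add: eventually_at_filter \<Psi>)
  then have "Lim (at \<alpha>) \<Psi> = E \<alpha>" by (intro tendsto_Lim) auto
  then have "dressing \<B> \<alpha> L K \<Phi> \<nu> y = E \<nu>" for \<nu>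
    using \<Psi> by (simp add: dressing_def \<Psi>_def[symmetric])
  then show "entire (\<lambda>\<mu>. dressing \<B> \<alpha> L K \<Phi> \<mu> y)" "det (dressing \<B> \<alpha> L K \<Phi> \<mu> y) = 1"
    using E det1 by simp_all
qed

theorem theorem8p6:
  fixes X :: "'a::t2_space set" and \<A> :: "'a chart set"
    and Y :: "'b::t2_space set" and \<B> :: "'b chart set"
    and p :: "'b \<Rightarrow> 'a" and \<tau> :: "'b \<Rightarrow> 'b"
    and \<xi> :: "complex \<Rightarrow> 'a form_coeffs" and \<Phi> :: "complex \<Rightarrow> 'b \<Rightarrow> mat2"
    and M :: "complex \<Rightarrow> mat2"
    and \<alpha> :: complex and L K :: "(complex^2) set"
  assumes "riemann_surface X \<A>" and "universal_cover Y \<B> p X \<A>"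
    and "lwr_potential \<A> \<xi>"
    and "lwr_frame Y \<B> p \<A> \<xi> \<Phi>" and "non_flat Y \<B> \<Phi>"
    and "deck_transformation Y p \<tau>" and "is_monodromy Y \<tau> \<Phi> M"
    and "is_line L" and "is_line K" and "L \<noteq> K"
    and "is_eigenline (M \<alpha>) L"
  shows "\<exists>Mhat. is_monodromy (dressing_domain Y \<B> \<alpha> L \<Phi>) \<tau> (dressing \<B> \<alpha> L K \<Phi>) Mhat \<and>
           (\<forall>N. is_monodromy (dressing_domain Y \<B> \<alpha> L \<Phi>) \<tau> (dressing \<B> \<alpha> L K \<Phi>) N
                  \<longrightarrow> N = Mhat) \<and>
           (\<forall>\<mu>. \<mu> \<noteq> \<alpha> \<longrightarrow>
              Mhat \<mu> = simple_factor \<alpha> L K \<mu> ** M \<mu> ** matrix_inv (simple_factor \<alpha> L K \<mu>))"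
proof -
  note X = assms(1) and U = assms(2) and F = assms(4) and LK = assms(8-10)
  let ?D = "dressing_domain Y \<B> \<alpha> L \<Phi>" and ?\<Psi> = "dressing \<B> \<alpha> L K \<Phi>"
  let ?g = "simple_factor \<alpha> L K"
  have M: "\<And>\<mu>. det (M \<mu>) = 1" "entire M" "\<And>y. y \<in> Y \<Longrightarrow> \<tau> y \<in> Y"
    "\<And>y \<mu>. y \<in> Y \<Longrightarrow> \<Phi> \<mu> (\<tau> y) = M \<mu> ** \<Phi> \<mu> y"
    using assms(7) by (auto simp: is_monodromy_def entire_def)
  have Minv: "invertible (M \<mu>)" for \<mu> using M(1) by (simp add: invertible_det_nz)
  obtain k where k: "\<And>v. v \<in> L \<Longrightarrow> M \<alpha> *v v = k *s v"
    using assms(11) by (auto simp: is_eigenline_def)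
  \<comment> \<open>the eigenvalue is not zero since \<open>M\<^sub>\<alpha>\<close> is invertible\<close>
  obtain v0 where v0: "v0 \<in> L" "v0 \<noteq> 0" using LK(1) by (auto simp: is_line_def intro: vec.span_base)
  have Miv: "matrix_inv (M \<alpha>) *v (M \<alpha> *v v) = v" for v
    by (simp add: matrix_vector_mul_assoc matrix_inv_cancel Minv)
  have k0: "k \<noteq> 0" using k[OF v0(1)] Miv[of v0] v0(2) by auto
  have Minv_L: "matrix_inv (M \<alpha>) *v v = (1/k) *s v" if "v \<in> L" for v
  proof -
    have "matrix_inv (M \<alpha>) *v (k *s v) = v" using Miv[of v] k[OF that] by simp
    then have "k *s (matrix_inv (M \<alpha>) *v v) = v" by (simp add: vector_scalar_commute)
    then have "(1/k) *s v = (1/k) *s (k *s (matrix_inv (M \<alpha>) *v v))" by simp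
    then show ?thesis using k0 by (simp only: vector_smult_assoc) simp
  qed
  obtain Mhat where Mh: "entire Mhat" "\<And>\<mu>. det (Mhat \<mu>) = det (M \<mu>)"
    "\<And>\<mu>. \<mu> \<noteq> \<alpha> \<Longrightarrow> Mhat \<mu> = ?g \<mu> ** M \<mu> ** matrix_inv (?g \<mu>)"
    using entire_simple_factor_conj[OF LK LK M(2)] k line_scale_mem[OF LK(1)] by metis
  have Phi_inv: "invertible (\<Phi> \<mu> y)" if "y \<in> Y" for \<mu> y
    using F that by (auto simp: lwr_frame_def invertible_det_nz)
  have line: "dressing_line \<alpha> L \<Phi> (\<tau> y) = dressing_line \<alpha> L \<Phi> y" if y: "y \<in> Y" for y
  proof -
    have *: "matrix_inv (\<Phi> \<alpha> (\<tau> y)) *v v = matrix_inv (\<Phi> \<alpha> y) *v ((1/k) *s v)" if "v \<in> L" for v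
      using Minv_L[OF that]
      by (simp add: M(4)[OF y] matrix_inv_mult[OF Minv Phi_inv[OF y]] matrix_vector_mul_assoc[symmetric])
    have "dressing_line \<alpha> L \<Phi> (\<tau> y) = (\<lambda>v. matrix_inv (\<Phi> \<alpha> y) *v v) ` ((*s) (1/k) ` L)"
      unfolding dressing_line_def image_image by (rule image_cong) (auto simp: *)
    also have "(*s) (1/k) ` L = L"
    proof
      show "(*s) (1/k) ` L \<subseteq> L" using line_scale_mem[OF LK(1)] by auto
      show "L \<subseteq> (*s) (1/k) ` L"
      proof
        fix v assume "v \<in> L"
        then have "k *s v \<in> L" by (rule line_scale_mem[OF LK(1)])
        moreover have "v = (1/k) *s (k *s v)" using k0 by (simp add: vector_smult_assoc)
        ultimately show "v \<in> (*s) (1/k) ` L" by blast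
      qed
    qed
    finally show ?thesis by (simp add: dressing_line_def)
  qed
  have spin: "spinor_span \<B> (frame_form \<Phi>) (\<tau> y) = spinor_span \<B> (frame_form \<Phi>) y" if y: "y \<in> Y" for y
  proof -
    have p: "p (\<tau> y) = p y" using assms(6) y by (auto simp: deck_transformation_def)
    have "p y \<in> X" using U y by (auto simp: universal_cover_def covering_space_def)
    then obtain d where "d \<in> \<A>" "p y \<in> chart_dom d" using X by (auto simp: riemann_surface_def)
    then show ?thesis
      using spinor_span_eq_base[OF X U F y] spinor_span_eq_base[OF X U F M(3)[OF y]] p by metis
  qed
  have DY: "y \<in> Y" if "y \<in> ?D" for y using that by (auto simp: dressing_domain_def)
  have D: "\<tau> y \<in> ?D" if "y \<in> ?D" for y
    using that by (simp add: dressing_domain_def line spin M(3))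
  have mono: "?\<Psi> \<mu> (\<tau> y) = Mhat \<mu> ** ?\<Psi> \<mu> y" if y: "y \<in> ?D" for y \<mu>
  proof -
    have "(\<lambda>\<mu>. ?\<Psi> \<mu> (\<tau> y)) = (\<lambda>\<mu>. Mhat \<mu> ** ?\<Psi> \<mu> y)"
    proof (rule entire_eqI[where \<alpha> = \<alpha>])
      show "entire (\<lambda>\<mu>. ?\<Psi> \<mu> (\<tau> y))" by (rule dressing_entire[OF F LK D[OF y]])
      show "entire (\<lambda>\<mu>. Mhat \<mu> ** ?\<Psi> \<mu> y)" by (intro entire_mult Mh dressing_entire[OF F LK y])
    next
      fix \<mu> assume "\<mu> \<noteq> \<alpha>"
      let ?h = "dressing_factor \<B> \<alpha> L \<Phi> \<mu> y"
      have h: "dressing_factor \<B> \<alpha> L \<Phi> \<mu> (\<tau> y) = ?h"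
        by (simp add: dressing_factor_def line spin DY[OF y])
      have ginv: "invertible (?g \<mu>)"
      proof -
        obtain S where S: "adapted L K S" using adapted_exists[OF LK] by blast
        then have "det S * det (matrix_inv S) = 1"
          by (metis adapted_def det_I det_mul matrix_inv_cancel(2))
        then show ?thesis using \<open>\<mu> \<noteq> \<alpha>\<close>
          by (auto simp: simple_factor_eq[OF LK(1,2) S] invertible_det_nz det_mul det_diag1)
      qed
      have "Mhat \<mu> ** ?\<Psi> \<mu> y =
          ?g \<mu> ** M \<mu> ** (matrix_inv (?g \<mu>) ** ?g \<mu>) ** \<Phi> \<mu> y ** matrix_inv ?h"
        using \<open>\<mu> \<noteq> \<alpha>\<close> by (simp add: Mh(3) dressing_def matrix_mul_assoc)
      also have "\<dots> = ?g \<mu> ** (M \<mu> ** \<Phi> \<mu> y) ** matrix_inv ?h"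
        using ginv by (simp add: matrix_inv_cancel matrix_mul_assoc)
      also have "\<dots> = ?\<Psi> \<mu> (\<tau> y)"
        using \<open>\<mu> \<noteq> \<alpha>\<close> by (simp add: dressing_def h M(4)[OF DY[OF y]])
      finally show "?\<Psi> \<mu> (\<tau> y) = Mhat \<mu> ** ?\<Psi> \<mu> y" by simp
    qed
    then show ?thesis by meson
  qed
  obtain y where y: "y \<in> ?D"
    using dressing_domain_nonempty[OF X U assms(3) F assms(5) LK(1)] by blast
  show ?thesis
  proof (intro exI conjI allI impI)
    show "is_monodromy ?D \<tau> ?\<Psi> Mhat"
      using Mh(1,2) M(1) D mono by (auto simp: is_monodromy_def entire_def)
    show "N = Mhat" if N: "is_monodromy ?D \<tau> ?\<Psi> N" for N
    proof
      fix \<mu>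
      have "N \<mu> ** ?\<Psi> \<mu> y = Mhat \<mu> ** ?\<Psi> \<mu> y"
        using N y mono[OF y, of \<mu>] by (metis is_monodromy_def)
      then show "N \<mu> = Mhat \<mu>"
        by (rule mat2_cancel_right) (simp add: dressing_entire(2)[OF F LK y])
    qed
  qed (use Mh(3) in auto)
qed

end
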